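(* Let $d>1$ be an integer and let $\mathbf{K}$ be an $\mathbf{o}$-symmetric convex body in $\mathbb{R}^d$. Let $r>0$, $\lambda>0$, let $N\geq 2^d$ be an integer, and let $Q=\{\mathbf{q}_1,\dots,\mathbf{q}_N\}\subset\mathbb{R}^d$ be a uniform contraction of $P=\{\mathbf{p}_1,\dots,\mathbf{p}_N\}\subset\mathbb{R}^d$ with separating value $\lambda$ in $\mathbb{M}^d_{\mathbf{K}}$. Then $$V_d(Q_r^{\mathbf{K}})\leq V_d(P_r^{\mathbf{K}}).$$
   Context: An $\mathbf{o}$-symmetric convex body $\mathbf{K}\subset\mathbb{R}^d$ is a compact convex set with nonempty interior that is symmetric about the origin $\mathbf{o}$. It generates the norm $\|\mathbf{x}\|_{\mathbf{K}}:=\min\{\lambda\geq 0 \mid \lambda\text{-dilate } \lambda\mathbf{K} \text{ contains } \mathbf{x}\}$, and $\mathbb{M}^d_{\mathbf{K}}$ denotes $\mathbb{R}^d$ equipped with this norm. For $\mathbf{x}\in\mathbb{R}^d$ and $r>0$, $B_{\mathbf{K}}[\mathbf{x},r]:=\mathbf{x}+r\mathbf{K}$. For $X\subseteq\mathbb{R}^d$ and $r>0$, $X_r^{\mathbf{K}}:=\bigcup\{B_{\mathbf{K}}[\mathbf{x},r]\mid \mathbf{x}\in X\}$. The labeled point set $Q=\{\mathbf{q}_1,\dots,\mathbf{q}_N\}$ is a uniform contraction of the labeled point set $P=\{\mathbf{p}_1,\dots,\mathbf{p}_N\}$ with separating value $\lambda>0$ in $\mathbb{M}^d_{\mathbf{K}}$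 if $\|\mathbf{q}_i-\mathbf{q}_j\|_{\mathbf{K}}\leq\lambda\leq\|\mathbf{p}_i-\mathbf{p}_j\|_{\mathbf{K}}$ for all $1\leq i<j\leq N$. $V_d(\cdot)$ is Lebesgue measure in $\mathbb{R}^d$. *)

theory Defs
  imports "HOL-Analysis.Analysis"
begin

definition o_symmetric_convex_body :: "(real ^ 'd) set \<Rightarrow> bool" where
  "o_symmetric_convex_body K \<longleftrightarrow>
     compact K \<and> convex K \<and> interior K \<noteq> {} \<and> uminus ` K = K"

text \<open>The norm generated by \<open>K\<close>. The minimum is rendered by \<open>LEAST\<close>; it is attained
  whenever \<open>K\<close> is an origin-symmetric convex body (lemma \<open>norm_K_attained\<close>).\<close>

definition norm_K :: "(real ^ 'd) set \<Rightarrow> real ^ 'd \<Rightarrow> real" where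
  "norm_K K x = (LEAST t. 0 \<le> t \<and> x \<in> (*\<^sub>R) t ` K)"

definition ball_K :: "(real ^ 'd) set \<Rightarrow> real ^ 'd \<Rightarrow> real \<Rightarrow> (real ^ 'd) set" where
  "ball_K K x r = (+) x ` (*\<^sub>R) r ` K"

definition nbhd_K :: "(real ^ 'd) set \<Rightarrow> (real ^ 'd) set \<Rightarrow> real \<Rightarrow> (real ^ 'd) set" where
  "nbhd_K K X r = (\<Union>x\<in>X. ball_K K x r)"

text \<open>A labeled point set with \<open>N\<close> labels is a function on \<open>nat\<close>, of which only the values
  on \<open>{1..N}\<close> matter; points with different labels may coincide.\<close>

definition uniform_contraction ::
  "(real ^ 'd) set \<Rightarrow> nat \<Rightarrow> real \<Rightarrow> (nat \<Rightarrow> real ^ 'd) \<Rightarrow> (nat \<Rightarrow> real ^ 'd) \<Rightarrow> bool" where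
  "uniform_contraction K N l q p \<longleftrightarrow>
     0 < l \<and>
     (\<forall>i j. 1 \<le> i \<and> i < j \<and> j \<le> N \<longrightarrow>
        norm_K K (q i - q j) \<le> l \<and> l \<le> norm_K K (p i - p j))"

lemma zero_in_interior_o_symmetric:
  assumes "o_symmetric_convex_body K"
  shows "0 \<in> interior K"
proof -
  have cvx: "convex K" and sym: "uminus ` K = K"
    using assms by (auto simp: o_symmetric_convex_body_def)
  obtain x where x: "x \<in> interior K"
    using assms by (auto simp: o_symmetric_convex_body_def)
  have "uminus ` interior K = interior K"
    using interior_negations[of K] sym by simp
  then have "- x \<in> interior K" using x by blast
  then have "(1/2) *\<^sub>R x + (1/2) *\<^sub>R (- x) \<in> interior K"
    using convexD[OF convex_interior[OF cvx] x, of "- x" "1/2" "1/2"] by simp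
  then show ?thesis by simp
qed

lemma norm_K_attained:
  assumes "o_symmetric_convex_body K"
  shows "0 \<le> norm_K K x \<and> x \<in> (*\<^sub>R) (norm_K K x) ` K"
    and "\<And>t. 0 \<le> t \<Longrightarrow> x \<in> (*\<^sub>R) t ` K \<Longrightarrow> norm_K K x \<le> t"
proof -
  have cpt: "compact K" using assms by (simp add: o_symmetric_convex_body_def)
  obtain e where e: "e > 0" "cball 0 e \<subseteq> K"
    using zero_in_interior_o_symmetric[OF assms] mem_interior_cball by blast
  define T where "T = (norm x + 1) / e"
  have T: "T > 0" using e by (simp add: T_def add_nonneg_pos)
  have "norm ((1 / T) *\<^sub>R x) \<le> e"
  proof -
    have "norm ((1 / T) *\<^sub>R x) = e * (norm x / (norm x + 1))"
      using e T by (simp add: T_def add_nonneg_pos)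
    also have "\<dots> \<le> e * 1" using e by (intro mult_left_mono) (simp_all add: divide_simps add_nonneg_pos)
    finally show ?thesis by simp
  qed
  then have "(1 / T) *\<^sub>R x \<in> K" using e by auto
  then have xT: "x \<in> (*\<^sub>R) T ` K"
    using T by (intro image_eqI[where x = "(1 / T) *\<^sub>R x"]) auto
  define S where "S = fst ` (({0..T} \<times> K) \<inter> {z. fst z *\<^sub>R snd z = x})"
  have S_iff: "t \<in> S \<longleftrightarrow> 0 \<le> t \<and> t \<le> T \<and> x \<in> (*\<^sub>R) t ` K" for t
    unfolding S_def by force
  have "closed {z :: real \<times> (real ^ 'a). fst z *\<^sub>R snd z = x}"
    by (intro closed_Collect_eq continuous_intros)
  then have "compact S"
    unfolding S_def
    by (intro compact_continuous_image compact_Int_closed compact_Times cpt continuous_intros) auto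
  moreover have "T \<in> S" using S_iff T xT by simp
  ultimately obtain m where m: "m \<in> S" "\<And>t. t \<in> S \<Longrightarrow> m \<le> t"
    using compact_attains_inf[of S] by blast
  have least: "m \<le> t" if "0 \<le> t \<and> x \<in> (*\<^sub>R) t ` K" for t
    using that m S_iff by (cases "t \<le> T") (auto intro: order_trans)
  have eq: "norm_K K x = m"
    unfolding norm_K_def using least m(1) S_iff by (intro Least_equality) auto
  show "0 \<le> norm_K K x \<and> x \<in> (*\<^sub>R) (norm_K K x) ` K"
    using eq m(1) S_iff by simp
  show "\<And>t. 0 \<le> t \<Longrightarrow> x \<in> (*\<^sub>R) t ` K \<Longrightarrow> norm_K K x \<le> t"
    using eq least by simp
qed

end

theory Submission
  imports Defs
begin

text \<open>If \<open>l \<ge> 2 r\<close>, the balls of radius \<open>r\<close> around the points of \<open>P\<close> do not overlap. Their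
  union then has the largest measure that a union of \<open>N\<close> balls of radius \<open>r\<close> can have, and the
  claim follows from subadditivity (\<open>measure_packing_K\<close> and \<open>measure_nbhd_K_le_card\<close>).

  If \<open>l < 2 r\<close>, a ball of radius \<open>l / 2 + r\<close> separates the two volumes. On the one hand,
  the neighbourhood of \<open>Q\<close> has diameter at most \<open>l + 2 r\<close>, so by the isodiametric inequality
  it measures at most as much as such a ball (\<open>isodiametric_nbhd_K\<close>). On the other hand, the balls of
  radius \<open>l / 2\<close> around the \<open>N \<ge> 2 ^ d\<close> points of \<open>P\<close> do not overlap. Together they measure at
  least as much as a ball of radius \<open>l\<close>, and the neighbourhood of \<open>P\<close> contains the sum of their
  union and a ball of radius \<open>r - l / 2\<close>. By the Brunn--Minkowski inequality this sum measures
  at least as much as a ball of radius \<open>l + (r - l / 2) = l / 2 + r\<close>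
  (\<open>nbhd_K_packing_lower_bound\<close>).

  Both bounds rest on the Brunn--Minkowski inequality
  \<open>V (U + W) ^ (1 / d) \<ge> V U ^ (1 / d) + V W ^ (1 / d)\<close>, which is proved for open bounded sets
  (\<open>brunn_minkowski_open\<close>) by the method of Hadwiger and Ohmann. For two boxes it is the
  inequality of arithmetic and geometric means. Finite families of disjoint boxes are handled
  by induction on the number of boxes, where parallel hyperplanes cut both families in the
  same ratio (\<open>brunn_minkowski_glue\<close>), and open sets are exhausted by such families. Closed
  balls may be replaced by open ones throughout, as the boundary of a convex body is a null
  set.\<close>

section \<open>The Brunn--Minkowski inequality for boxes\<close>

text \<open>After division by the right-hand side this is the inequality between the geometric and
  the arithmetic mean, applied once to the ratios \<open>a i / (a i + b i)\<close> and once to the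
  ratios \<open>b i / (a i + b i)\<close>; the two arithmetic means add up to 1. For the side lengths
  of two boxes it is the Brunn--Minkowski inequality.\<close>

lemma root_prod_superadditive:
  fixes a b :: "'i \<Rightarrow> real"
  assumes "finite I" "I \<noteq> {}" and pos: "\<And>i. i \<in> I \<Longrightarrow> 0 < a i" "\<And>i. i \<in> I \<Longrightarrow> 0 < b i"
  shows "root (card I) (\<Prod>i\<in>I. a i) + root (card I) (\<Prod>i\<in>I. b i) \<le> root (card I) (\<Prod>i\<in>I. a i + b i)"
proof -
  define n where "n = card I"
  have n: "n > 0" using assms by (simp add: n_def card_gt_0_iff)
  have amgm: "root n (\<Prod>i\<in>I. x i) / root n (\<Prod>i\<in>I. a i + b i) \<le> (\<Sum>i\<in>I. x i / (a i + b i) / n)"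
    if x: "\<And>i. i \<in> I \<Longrightarrow> 0 < x i" for x
  proof -
    have "root n (\<Prod>i\<in>I. x i) / root n (\<Prod>i\<in>I. a i + b i) = root n (\<Prod>i\<in>I. x i / (a i + b i))"
      by (simp add: prod_dividef real_root_divide)
    also have "\<dots> = (\<Prod>i\<in>I. x i / (a i + b i)) powr (1 / n)"
      using x pos n by (subst root_powr_inverse) (auto intro!: prod_nonneg divide_nonneg_nonneg add_nonneg_nonneg intro: less_imp_le)
    also have "\<dots> \<le> (\<Sum>i\<in>I. x i / (a i + b i) / n)"
      unfolding n_def using x pos
      by (intro arith_geom_mean assms divide_nonneg_nonneg add_nonneg_nonneg) (auto intro: less_imp_le)
    finally show ?thesis .
  qed
  have R: "root n (\<Prod>i\<in>I. a i + b i) > 0"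
    using pos n by (auto intro!: prod_pos add_pos_pos simp: real_root_gt_zero)
  have "(root n (\<Prod>i\<in>I. a i) + root n (\<Prod>i\<in>I. b i)) / root n (\<Prod>i\<in>I. a i + b i)
        \<le> (\<Sum>i\<in>I. a i / (a i + b i) / n) + (\<Sum>i\<in>I. b i / (a i + b i) / n)"
    using amgm[of a] amgm[of b] pos by (simp add: add_divide_distrib)
  also have "\<dots> = (\<Sum>i\<in>I. 1 / n)"
    unfolding sum.distrib[symmetric]
  proof (rule sum.cong[OF refl])
    fix i assume "i \<in> I"
    then have "a i + b i \<noteq> 0" using pos[of i] by simp
    then show "a i / (a i + b i) / n + b i / (a i + b i) / n = 1 / n"
      by (simp add: add_divide_distrib[symmetric])
  qed
  also have "\<dots> = 1" using n by (simp add: n_def)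
  finally show ?thesis using R by (simp add: n_def divide_le_eq)
qed

text \<open>The inequality is taken in its \<open>d\<close>-th power form because this form can be summed
  over the two sides of a hyperplane.\<close>

definition brunn_minkowski :: "'a::euclidean_space set \<Rightarrow> 'a set \<Rightarrow> bool" where
  "brunn_minkowski A B \<longleftrightarrow>
     (root DIM('a) (measure lebesgue A) + root DIM('a) (measure lebesgue B)) ^ DIM('a)
       \<le> measure lebesgue (A + B)"

lemma brunn_minkowski_commute: "brunn_minkowski A B \<longleftrightarrow> brunn_minkowski B A"
  by (simp add: brunn_minkowski_def add.commute)

lemma set_plus_UN: "A + B = (\<Union>x\<in>A. \<Union>y\<in>B. {x + y})"
  by (auto simp: set_plus_def)

lemma lmeasurable_open_sum:
  fixes A B :: "'a::euclidean_space set"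
  assumes "open A" "bounded A" "bounded B"
  shows "A + B \<in> lmeasurable"
  unfolding set_plus_UN using assms by (intro lmeasurable_open open_sums bounded_sums) auto

text \<open>A point of the large box divides each of its sides in some ratio \<open>t i\<close>; the points
  that divide the sides of the two small boxes in the same ratios add up to it.\<close>

lemma box_sum_subset:
  fixes l u l' u' :: "'a::euclidean_space"
  assumes "box l u \<noteq> {}" "box l' u' \<noteq> {}"
  shows "box (l + l') (u + u') \<subseteq> box l u + box l' u'"
proof
  fix x assume x: "x \<in> box (l + l') (u + u')"
  have lu: "l \<bullet> i < u \<bullet> i" "l' \<bullet> i < u' \<bullet> i" if "i \<in> Basis" for i
    using assms that by (auto simp: box_ne_empty)
  define t where "t i = ((x - l - l') \<bullet> i) / ((u - l + (u' - l')) \<bullet> i)" for i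
  have t: "0 < t i" "t i < 1" if "i \<in> Basis" for i
    using x lu[OF that] that by (auto simp: t_def mem_box inner_simps divide_simps)
  define y where "y = (\<Sum>i\<in>Basis. (l \<bullet> i + t i * (u \<bullet> i - l \<bullet> i)) *\<^sub>R i)"
  have y: "y \<bullet> i = l \<bullet> i + t i * (u \<bullet> i - l \<bullet> i)" if "i \<in> Basis" for i
    using that by (simp add: y_def)
  have z: "(x - y) \<bullet> i = l' \<bullet> i + t i * (u' \<bullet> i - l' \<bullet> i)" if "i \<in> Basis" for i
  proof -
    have "t i * ((u - l + (u' - l')) \<bullet> i) = (x - l - l') \<bullet> i"
      using lu[OF that] by (simp add: t_def inner_simps)
    then show ?thesis using y[OF that] by (simp add: inner_simps algebra_simps)
  qed
  have conv: "p < p + s * (q - p)" "p + s * (q - p) < q" if "p < q" "0 < s" "s < 1" for p q s :: real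
  proof -
    have "s * (q - p) < 1 * (q - p)" using that by (intro mult_strict_right_mono) auto
    then show "p + s * (q - p) < q" by simp
  qed (use that in simp)
  have "y \<in> box l u" unfolding mem_box using y conv lu t by metis
  moreover have "x - y \<in> box l' u'" unfolding mem_box using z conv lu t by metis
  ultimately have "y + (x - y) \<in> box l u + box l' u'" by blast
  then show "x \<in> box l u + box l' u'" by simp
qed

lemma brunn_minkowski_box:
  fixes l u l' u' :: "'a::euclidean_space"
  assumes "box l u \<noteq> {}" "box l' u' \<noteq> {}"
  shows "brunn_minkowski (box l u) (box l' u')"
proof -
  have lu: "l \<bullet> i < u \<bullet> i" "l' \<bullet> i < u' \<bullet> i" if "i \<in> Basis" for i
    using assms that by (auto simp: box_ne_empty)
  have ms: "measure lebesgue (box a b) = (\<Prod>i\<in>Basis. (b - a) \<bullet> i)"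
    if "\<And>i. i \<in> Basis \<Longrightarrow> a \<bullet> i < b \<bullet> i" for a b :: 'a
    using that by (auto simp: measure_lborel_box_eq less_imp_le)
  have m1: "measure lebesgue (box l u) = (\<Prod>i\<in>Basis. (u - l) \<bullet> i)"
    and m2: "measure lebesgue (box l' u') = (\<Prod>i\<in>Basis. (u' - l') \<bullet> i)"
    by (intro ms lu; assumption)+
  have "root DIM('a) (measure lebesgue (box l u)) + root DIM('a) (measure lebesgue (box l' u'))
        \<le> root DIM('a) (\<Prod>i\<in>Basis. (u - l) \<bullet> i + (u' - l') \<bullet> i)"
    unfolding m1 m2
    using lu root_prod_superadditive[of Basis "\<lambda>i. (u - l) \<bullet> i" "\<lambda>i. (u' - l') \<bullet> i"]
    by (simp add: inner_diff_left)
  also have "(\<Prod>i\<in>Basis. (u - l) \<bullet> i + (u' - l') \<bullet> i) = measure lebesgue (box (l + l') (u + u'))"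
    using lu by (subst ms) (auto simp: inner_simps algebra_simps add_strict_mono intro!: prod.cong)
  finally have "(root DIM('a) (measure lebesgue (box l u)) + root DIM('a) (measure lebesgue (box l' u'))) ^ DIM('a)
     \<le> root DIM('a) (measure lebesgue (box (l + l') (u + u'))) ^ DIM('a)"
    by (intro power_mono) (auto intro!: add_nonneg_nonneg real_root_ge_zero)
  also have "\<dots> = measure lebesgue (box (l + l') (u + u'))"
    by (intro real_root_pow_pos2) auto
  also have "\<dots> \<le> measure lebesgue (box l u + box l' u')"
    using box_sum_subset[OF assms]
    by (intro measure_mono_fmeasurable lmeasurable_open_sum) auto
  finally show ?thesis unfolding brunn_minkowski_def .
qed

section \<open>Cutting by parallel hyperplanes\<close>

lemma measure_halfspace_split:
  fixes U :: "'a::euclidean_space set"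
  assumes "U \<in> lmeasurable" "k \<in> Basis"
  shows "measure lebesgue U = measure lebesgue (U \<inter> {x. x \<bullet> k < c}) + measure lebesgue (U \<inter> {x. c < x \<bullet> k})"
proof -
  have m: "U \<inter> {x. x \<bullet> k < c} \<in> lmeasurable" "U \<inter> {x. c < x \<bullet> k} \<in> lmeasurable"
    using assms by (auto intro!: fmeasurable_Int_fmeasurable borel_open open_Collect_less continuous_intros)
  have "measure lebesgue U = measure lebesgue (U \<inter> {x. x \<bullet> k < c} \<union> U \<inter> {x. c < x \<bullet> k})"
  proof (rule measure_negligible_symdiff)
    show "U \<inter> {x. x \<bullet> k < c} \<union> U \<inter> {x. c < x \<bullet> k} \<in> lmeasurable"
      using m by auto
    have "negligible {x. x \<bullet> k = c}" using assms by (simp add: negligible_standard_hyperplane)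
    then show "negligible (U \<inter> {x. x \<bullet> k < c} \<union> U \<inter> {x. c < x \<bullet> k} - U \<union>
        (U - (U \<inter> {x. x \<bullet> k < c} \<union> U \<inter> {x. c < x \<bullet> k})))"
      by (rule negligible_subset) auto
  qed
  also have "\<dots> = measure lebesgue (U \<inter> {x. x \<bullet> k < c}) + measure lebesgue (U \<inter> {x. c < x \<bullet> k})"
  proof -
    have "U \<inter> {x. x \<bullet> k < c} \<inter> (U \<inter> {x. c < x \<bullet> k}) = {}" by auto
    then show ?thesis using m by (subst measure_Un3) auto
  qed
  finally show ?thesis .
qed

text \<open>A bounded set is cut in any prescribed ratio by a hyperplane orthogonal to \<open>k\<close>. The
  measure on one side is continuous in the position of the hyperplane, since moving the
  hyperplane a little only affects a thin slab of a surrounding box.\<close>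

lemma halfspace_measure_IVT:
  fixes U :: "'a::euclidean_space set"
  assumes U: "U \<in> lmeasurable" "bounded U" and k: "k \<in> Basis"
    and t: "0 \<le> t" "t \<le> measure lebesgue U"
  obtains c where "measure lebesgue (U \<inter> {x. x \<bullet> k < c}) = t"
proof -
  define f where "f c = measure lebesgue (U \<inter> {x. x \<bullet> k < c})" for c
  have m: "U \<inter> {x. x \<bullet> k < c} \<in> lmeasurable" for c
    using U by (auto intro!: fmeasurable_Int_fmeasurable borel_open open_Collect_less continuous_intros)
  obtain a b where ab: "U \<subseteq> cbox a b" using bounded_subset_cbox_symmetric[OF U(2)] by blast
  define strip where "strip c d = cbox a b \<inter> {x. \<bar>x \<bullet> k - c\<bar> \<le> d}" for c d
  have strip: "strip c d \<in> lmeasurable" for c d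
    unfolding strip_def
    by (intro fmeasurable_Int_fmeasurable) (auto intro!: borel_closed closed_Collect_le continuous_intros)
  have step: "f c' \<le> f c + measure lebesgue (strip c'' d)"
    if "c'' \<in> {c, c'}" "\<bar>c' - c\<bar> < d" for c c' c'' d
  proof -
    have "f c' \<le> measure lebesgue (U \<inter> {x. x \<bullet> k < c} \<union> strip c'' d)"
      unfolding f_def using that ab m[of c'] fmeasurable.Un[OF m[of c] strip[of c'' d]]
      by (intro measure_mono_fmeasurable) (auto simp: strip_def)
    also have "\<dots> \<le> f c + measure lebesgue (strip c'' d)"
      unfolding f_def using m strip by (intro measure_Un_le) auto
    finally show ?thesis .
  qed
  have "isCont f c" for c
    unfolding isCont_def tendsto_iff
  proof (intro allI impI)
    fix e :: real assume "0 < e"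
    then obtain d where d: "d > 0" "measure lebesgue (strip c d) < e"
      using content_doublesplit[OF _ k, of e a b c] strip by (auto simp: strip_def)
    have "dist (f c') (f c) < e" if "dist c' c < d" for c'
      using step[of c c c' d] step[of c c' c d] that d(2) by (auto simp: dist_real_def abs_minus_commute)
    then show "\<forall>\<^sub>F c' in at c. dist (f c') (f c) < e"
      using d(1) by (auto simp: eventually_at)
  qed
  moreover have "f (a \<bullet> k) = 0"
  proof -
    have "U \<inter> {x. x \<bullet> k < a \<bullet> k} = {}" using ab k by (force simp: subset_iff mem_box not_less)
    then show ?thesis by (simp add: f_def)
  qed
  moreover have "f (max (a \<bullet> k) (b \<bullet> k + 1)) = measure lebesgue U"
  \<comment> \<open>The summand 1 matters: the half-space is open and the surrounding box is closed.\<close>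
  proof -
    have "U \<inter> {x. x \<bullet> k < max (a \<bullet> k) (b \<bullet> k + 1)} = U"
      using ab k by (force simp: subset_iff mem_box less_max_iff_disj)
    then show ?thesis by (simp add: f_def)
  qed
  ultimately obtain c where "f c = t"
    using IVT'[of f "a \<bullet> k" t "max (a \<bullet> k) (b \<bullet> k + 1)"] t
    by (auto intro!: continuous_at_imp_continuous_on)
  then show ?thesis using that by (simp add: f_def)
qed

text \<open>The Hadwiger--Ohmann step. If two parallel hyperplanes cut \<open>U\<close> and \<open>W\<close> in the same
  ratio \<open>\<theta>\<close>, then the sums of the lower parts and of the upper parts are separated by a
  hyperplane inside \<open>U + W\<close>, so their measures add. The common ratio makes the bounds for
  the parts equal to \<open>\<theta>\<close> and \<open>1 - \<theta>\<close> times the bound wanted for the whole.\<close>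

lemma brunn_minkowski_glue:
  fixes U W :: "'a::euclidean_space set"
  assumes U: "open U" "bounded U" and W: "open W" "bounded W" and k: "k \<in> Basis"
    and \<theta>: "0 \<le> \<theta>" "\<theta> \<le> 1"
    and mU: "measure lebesgue (U \<inter> {x. x \<bullet> k < c}) = \<theta> * measure lebesgue U"
    and mW: "measure lebesgue (W \<inter> {x. x \<bullet> k < c'}) = \<theta> * measure lebesgue W"
    and lower: "brunn_minkowski (U \<inter> {x. x \<bullet> k < c}) (W \<inter> {x. x \<bullet> k < c'})"
    and upper: "brunn_minkowski (U \<inter> {x. c < x \<bullet> k}) (W \<inter> {x. c' < x \<bullet> k})"
  shows "brunn_minkowski U W"
proof -
  let ?n = "DIM('a)" and ?U1 = "U \<inter> {x. x \<bullet> k < c}" and ?U2 = "U \<inter> {x. c < x \<bullet> k}"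
    and ?W1 = "W \<inter> {x. x \<bullet> k < c'}" and ?W2 = "W \<inter> {x. c' < x \<bullet> k}"
  define s where "s = root ?n (measure lebesgue U) + root ?n (measure lebesgue W)"
  have mU': "measure lebesgue ?U2 = (1 - \<theta>) * measure lebesgue U"
    using measure_halfspace_split[of U k c] U k mU by (simp add: lmeasurable_open algebra_simps)
  have mW': "measure lebesgue ?W2 = (1 - \<theta>) * measure lebesgue W"
    using measure_halfspace_split[of W k c'] W k mW by (simp add: lmeasurable_open algebra_simps)
  have pow: "(root ?n (\<mu> * measure lebesgue U) + root ?n (\<mu> * measure lebesgue W)) ^ ?n = \<mu> * s ^ ?n"
    if "0 \<le> \<mu>" for \<mu>
    using that by (simp add: s_def real_root_mult distrib_left[symmetric] power_mult_distrib real_root_pow_pos2)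
  have sub: "?U1 + ?W1 \<subseteq> (U + W) \<inter> {x. x \<bullet> k < c + c'}" "?U2 + ?W2 \<subseteq> (U + W) \<inter> {x. c + c' < x \<bullet> k}"
    by (auto simp: set_plus_def inner_add_left)
  have op: "open ?U1" "open ?W1" "open ?U2" "open ?W2"
    using U W by (auto intro!: open_Int open_Collect_less continuous_intros)
  have bd: "bounded ?U1" "bounded ?W1" "bounded ?U2" "bounded ?W2"
    using U W by (auto intro: bounded_subset)
  have UW: "U + W \<in> lmeasurable" using U W by (intro lmeasurable_open_sum)
  have UWH: "(U + W) \<inter> {x. x \<bullet> k < c + c'} \<in> lmeasurable" "(U + W) \<inter> {x. c + c' < x \<bullet> k} \<in> lmeasurable"
    using UW by (auto intro!: fmeasurable_Int_fmeasurable borel_open open_Collect_less continuous_intros)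
  have "s ^ ?n = \<theta> * s ^ ?n + (1 - \<theta>) * s ^ ?n" by (simp add: algebra_simps)
  also have "\<dots> \<le> measure lebesgue (?U1 + ?W1) + measure lebesgue (?U2 + ?W2)"
    using lower upper \<theta> pow[of \<theta>] pow[of "1 - \<theta>"]
    by (simp add: brunn_minkowski_def mU mW mU' mW')
  also have "\<dots> \<le> measure lebesgue ((U + W) \<inter> {x. x \<bullet> k < c + c'}) + measure lebesgue ((U + W) \<inter> {x. c + c' < x \<bullet> k})"
    using sub UWH op bd
    by (intro add_mono measure_mono_fmeasurable fmeasurableD lmeasurable_open_sum) auto
  also have "\<dots> = measure lebesgue (U + W)"
    using measure_halfspace_split[OF UW k] by simp
  finally show ?thesis by (simp add: brunn_minkowski_def s_def)
qed

section \<open>Finite families of disjoint boxes\<close>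

lemma measure_open_pos:
  fixes U :: "'a::euclidean_space set"
  assumes "open U" "bounded U" "U \<noteq> {}"
  shows "0 < measure lebesgue U"
proof -
  have "\<not> negligible U" using assms(1,3) by (rule open_not_negligible)
  then have "measure lebesgue U \<noteq> 0"
    using assms by (simp add: negligible_iff_measure lmeasurable_open del: measure_completion)
  then show ?thesis using measure_nonneg[of lebesgue U] by linarith
qed

definition box_family :: "'a::euclidean_space set set \<Rightarrow> bool" where
  "box_family \<A> \<longleftrightarrow> finite \<A> \<and> \<A> \<noteq> {} \<and> disjoint \<A> \<and> (\<forall>a\<in>\<A>. a \<noteq> {} \<and> (\<exists>l u. a = box l u))"

lemma box_family_Union:
  assumes "box_family \<A>"
  shows "open (\<Union>\<A>)" "bounded (\<Union>\<A>)" "0 < measure lebesgue (\<Union>\<A>)"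
proof -
  have boxes: "open a" "bounded a" if "a \<in> \<A>" for a
    using assms that unfolding box_family_def by (metis open_box, metis bounded_box)
  show op: "open (\<Union>\<A>)" using boxes by (intro open_Union ballI)
  show bd: "bounded (\<Union>\<A>)"
    using boxes assms by (intro bounded_Union ballI) (simp_all add: box_family_def)
  have "\<Union>\<A> \<noteq> {}" using assms by (auto simp: box_family_def)
  then show "0 < measure lebesgue (\<Union>\<A>)"
    using op bd by (rule measure_open_pos[rotated 2])
qed

definition slice :: "'a set \<Rightarrow> 'a set set \<Rightarrow> 'a set set" where
  "slice H \<A> = (\<lambda>a. a \<inter> H) ` \<A> - {{}}"

lemma Union_slice: "\<Union>(slice H \<A>) = \<Union>\<A> \<inter> H"
  by (auto simp: slice_def)

lemma card_slice_le: "finite \<A> \<Longrightarrow> card (slice H \<A>) \<le> card \<A>"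
  unfolding slice_def
  by (rule le_trans[OF card_mono[OF finite_imageI Diff_subset] card_image_le])

lemma card_slice_less:
  assumes "finite \<A>" "a \<in> \<A>" "a \<inter> H = {}"
  shows "card (slice H \<A>) < card \<A>"
proof -
  have "slice H \<A> \<subseteq> (\<lambda>a. a \<inter> H) ` (\<A> - {a})"
    using assms by (auto simp: slice_def)
  then have "card (slice H \<A>) \<le> card (\<A> - {a})"
    using assms(1) by (intro le_trans[OF card_mono card_image_le]) auto
  also have "\<dots> < card \<A>" using assms(1,2) by (rule card_Diff1_less)
  finally show ?thesis .
qed

text \<open>A half-space bounded by a coordinate hyperplane cuts a box in a box, so cutting leads
  again to a family of disjoint boxes.\<close>

lemma box_family_slice:
  fixes k :: "'a::euclidean_space"
  assumes A: "box_family \<A>" and H: "H = {x. x \<bullet> k < c} \<or> H = {x. c < x \<bullet> k}" "k \<in> Basis"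
    and ne: "\<Union>\<A> \<inter> H \<noteq> {}"
  shows "box_family (slice H \<A>)"
  unfolding box_family_def
proof (intro conjI ballI)
  show "finite (slice H \<A>)" using A by (simp add: slice_def box_family_def)
  show "slice H \<A> \<noteq> {}" using ne by (auto simp: slice_def)
  show "disjoint (slice H \<A>)"
  proof (rule disjointI)
    fix s t assume st: "s \<in> slice H \<A>" "t \<in> slice H \<A>" "s \<noteq> t"
    then obtain a b where ab: "a \<in> \<A>" "s = a \<inter> H" "b \<in> \<A>" "t = b \<inter> H"
      by (auto simp: slice_def)
    then have "a \<inter> b = {}"
      using A st(3) disjointD[of \<A> a b] by (auto simp: box_family_def)
    then show "s \<inter> t = {}" using ab by auto
  qed
  fix b assume b: "b \<in> slice H \<A>"
  then show "b \<noteq> {}" by (simp add: slice_def)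
  obtain a where a: "a \<in> \<A>" "b = a \<inter> H" using b by (auto simp: slice_def)
  then have "\<exists>l u. a = box l u" using A by (simp add: box_family_def)
  then obtain l u where lu: "b = box l u \<inter> H" using a(2) by auto
  have "box l u \<inter> {x. x \<bullet> k < c} = box l (\<Sum>i\<in>Basis. (if i = k then min (u \<bullet> k) c else u \<bullet> i) *\<^sub>R i)"
    "box l u \<inter> {x. c < x \<bullet> k} = box (\<Sum>i\<in>Basis. (if i = k then max (l \<bullet> k) c else l \<bullet> i) *\<^sub>R i) u"
    using H(2) by (rule_tac set_eqI; auto simp: mem_box)+
  then show "\<exists>l u. b = box l u" using H(1) unfolding lu by blast
qed

text \<open>The hyperplane used in the induction: it has at least one whole box on either side, so
  both parts of the family have fewer members than the family, although the remaining boxes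
  may be cut in two.\<close>

lemma box_family_separate:
  fixes \<A> :: "'a::euclidean_space set set"
  assumes A: "box_family \<A>" and "2 \<le> card \<A>"
  obtains k c a b where "k \<in> Basis" "a \<in> \<A>" "b \<in> \<A>" "a \<subseteq> {x. x \<bullet> k < c}" "b \<subseteq> {x. c < x \<bullet> k}"
proof -
  obtain a b where ab: "a \<in> \<A>" "b \<in> \<A>" "a \<noteq> b"
    using A assms(2) card_le_Suc0_iff_eq[of \<A>] by (auto simp: box_family_def)
  with A obtain l u l' u' where lu: "a = box l u" "b = box l' u'" "box l u \<noteq> {}" "box l' u' \<noteq> {}"
    by (metis box_family_def)
  have "box l u \<inter> box l' u' = {}"
    using A ab lu by (metis box_family_def disjointD)
  then obtain k where k: "k \<in> Basis" "u \<bullet> k \<le> l' \<bullet> k \<or> u' \<bullet> k \<le> l \<bullet> k"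
    using lu(3,4) unfolding disjoint_interval box_ne_empty by (meson not_less)
  then consider "u \<bullet> k \<le> l' \<bullet> k" | "u' \<bullet> k \<le> l \<bullet> k" by blast
  then show ?thesis
  proof cases
    case 1
    then show ?thesis
      using ab k lu by (intro that[of k a b "u \<bullet> k"]) (auto simp: mem_box intro: le_less_trans)
  next
    case 2
    then show ?thesis
      using ab k lu by (intro that[of k b a "u' \<bullet> k"]) (auto simp: mem_box intro: le_less_trans)
  qed
qed

text \<open>Induction on the total number of boxes. A family with at least two members is split by a
  hyperplane that reduces the number of boxes on both sides; the other family is cut by a
  parallel hyperplane in the same ratio, which does not increase its number of boxes. Two
  single boxes are the base case.\<close>

lemma brunn_minkowski_box_family:
  fixes \<A> \<B> :: "'a::euclidean_space set set"
  assumes "box_family \<A>" "box_family \<B>"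
  shows "brunn_minkowski (\<Union>\<A>) (\<Union>\<B>)"
  using assms
proof (induction "card \<A> + card \<B>" arbitrary: \<A> \<B> rule: less_induct)
  case less
  have split: "brunn_minkowski (\<Union>\<C>) (\<Union>\<D>)"
    if C: "box_family \<C>" and D: "box_family \<D>" and two: "2 \<le> card \<C>"
      and IH: "\<And>\<C>' \<D>' :: 'a set set. card \<C>' + card \<D>' < card \<C> + card \<D> \<Longrightarrow> box_family \<C>' \<Longrightarrow>
                 box_family \<D>' \<Longrightarrow> brunn_minkowski (\<Union>\<C>') (\<Union>\<D>')" for \<C> \<D> :: "'a set set"
  proof -
    obtain k c a b where k: "k \<in> Basis" and ab: "a \<in> \<C>" "b \<in> \<C>"
      and a: "a \<subseteq> {x. x \<bullet> k < c}" and b: "b \<subseteq> {x. c < x \<bullet> k}"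
      using box_family_separate[OF C two] .
    have fin: "finite \<C>" "finite \<D>" and ne: "a \<noteq> {}" "b \<noteq> {}"
      using C D ab by (auto simp: box_family_def)
    have lm: "\<Union>\<C> \<in> lmeasurable" "\<Union>\<D> \<in> lmeasurable"
      using box_family_Union[OF C] box_family_Union[OF D] by (auto intro: lmeasurable_open)
    define L where "L c = {x::'a. x \<bullet> k < c}" for c
    define R where "R c = {x::'a. c < x \<bullet> k}" for c
    have C1: "box_family (slice (L c) \<C>)" and C2: "box_family (slice (R c) \<C>)"
      using C k a b ab ne by (auto intro!: box_family_slice simp: L_def R_def)
    have pos: "0 < measure lebesgue (\<Union>\<C> \<inter> L c)" "0 < measure lebesgue (\<Union>\<C> \<inter> R c)"
      using box_family_Union(3)[OF C1] box_family_Union(3)[OF C2] by (simp_all add: Union_slice)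
    have mC: "measure lebesgue (\<Union>\<C>) = measure lebesgue (\<Union>\<C> \<inter> L c) + measure lebesgue (\<Union>\<C> \<inter> R c)"
      unfolding L_def R_def by (rule measure_halfspace_split[OF lm(1) k])
    define \<theta> where "\<theta> = measure lebesgue (\<Union>\<C> \<inter> L c) / measure lebesgue (\<Union>\<C>)"
    have \<theta>: "0 < \<theta>" "\<theta> < 1" using pos mC by (auto simp: \<theta>_def divide_simps)
    have Dpos: "0 < measure lebesgue (\<Union>\<D>)" by (rule box_family_Union(3)[OF D])
    obtain c' where c': "measure lebesgue (\<Union>\<D> \<inter> L c') = \<theta> * measure lebesgue (\<Union>\<D>)"
      unfolding L_def
      using halfspace_measure_IVT[OF lm(2) box_family_Union(2)[OF D] k, of "\<theta> * measure lebesgue (\<Union>\<D>)"]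
        \<theta> Dpos by (auto simp: mult_le_cancel_right1)
    have "measure lebesgue (\<Union>\<D>) = measure lebesgue (\<Union>\<D> \<inter> L c') + measure lebesgue (\<Union>\<D> \<inter> R c')"
      unfolding L_def R_def by (rule measure_halfspace_split[OF lm(2) k])
    then have "measure lebesgue (\<Union>\<D> \<inter> R c') = (1 - \<theta>) * measure lebesgue (\<Union>\<D>)"
      using c' by (simp add: algebra_simps)
    then have "0 < measure lebesgue (\<Union>\<D> \<inter> L c')" "0 < measure lebesgue (\<Union>\<D> \<inter> R c')"
      using c' \<theta> Dpos by simp_all
    then have ne': "\<Union>\<D> \<inter> L c' \<noteq> {}" "\<Union>\<D> \<inter> R c' \<noteq> {}" by force+
    have D1: "box_family (slice (L c') \<D>)" and D2: "box_family (slice (R c') \<D>)"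
      using ne' by (auto intro!: box_family_slice[OF D _ k] simp: L_def R_def)
    have "b \<inter> L c = {}" "a \<inter> R c = {}" using a b by (auto simp: L_def R_def)
    then have smaller: "card (slice (L c) \<C>) < card \<C>" "card (slice (R c) \<C>) < card \<C>"
      using card_slice_less[OF fin(1) ab(2)] card_slice_less[OF fin(1) ab(1)] by blast+
    have "brunn_minkowski (\<Union>\<C> \<inter> L c) (\<Union>\<D> \<inter> L c')" "brunn_minkowski (\<Union>\<C> \<inter> R c) (\<Union>\<D> \<inter> R c')"
      unfolding Union_slice[symmetric]
      using IH[OF add_less_le_mono[OF smaller(1) card_slice_le[OF fin(2)]] C1 D1]
        IH[OF add_less_le_mono[OF smaller(2) card_slice_le[OF fin(2)]] C2 D2] by simp_all
    moreover have "measure lebesgue (\<Union>\<C> \<inter> L c) = \<theta> * measure lebesgue (\<Union>\<C>)"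
      using pos mC by (simp add: \<theta>_def)
    ultimately show ?thesis
      using brunn_minkowski_glue[OF box_family_Union(1,2)[OF C] box_family_Union(1,2)[OF D] k
          less_imp_le[OF \<theta>(1)] less_imp_le[OF \<theta>(2)], of c c'] c'
      unfolding L_def R_def by blast
  qed
  consider "2 \<le> card \<A>" | "2 \<le> card \<B>" | "card \<A> = 1" "card \<B> = 1"
  proof -
    have "card \<A> \<noteq> 0" "card \<B> \<noteq> 0" using less.prems by (simp_all add: box_family_def)
    then show thesis using that by linarith
  qed
  then show ?case
  proof cases
    case 1
    show ?thesis by (rule split[OF less.prems 1 less.hyps])
  next
    case 2
    have "brunn_minkowski (\<Union>\<B>) (\<Union>\<A>)"
      by (rule split[OF less.prems(2,1) 2 less.hyps]) (simp_all add: add.commute)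
    then show ?thesis by (simp add: brunn_minkowski_commute)
  next
    case 3
    then obtain a b where ab: "\<A> = {a}" "\<B> = {b}" by (meson card_1_singletonE)
    have "\<exists>l u. a = box l u" "a \<noteq> {}" "\<exists>l u. b = box l u" "b \<noteq> {}"
      using less.prems ab by (simp_all add: box_family_def)
    then show ?thesis using ab by (auto intro: brunn_minkowski_box)
  qed
qed

section \<open>The Brunn--Minkowski inequality for open sets\<close>

text \<open>Finitely many closed boxes contained in \<open>U\<close> exhaust its measure up to any tolerance.
  Their union has a division into boxes without common interior points, and the interiors of
  the parts are disjoint open boxes that miss only a null set.\<close>

lemma box_family_approximates_open:
  fixes U :: "'a::euclidean_space set"
  assumes U: "open U" "bounded U" and t: "0 \<le> t" "t < measure lebesgue U"
  obtains \<A> where "box_family \<A>" "\<Union>\<A> \<subseteq> U" "t < measure lebesgue (\<Union>\<A>)"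
proof -
  obtain \<D> where D: "countable \<D>" "\<D> \<subseteq> Pow U" "\<And>X. X \<in> \<D> \<Longrightarrow> \<exists>a b. X = cbox a b" "\<Union>\<D> = U"
    using open_countable_Union_open_cbox[OF U(1)] by metis
  have lmU: "U \<in> lmeasurable" using U by (simp add: lmeasurable_open)
  have lmD: "X \<in> lmeasurable" if "X \<in> \<D>" for X using D(3)[OF that] by auto
  have bnd: "measure lebesgue (\<Union>D') \<le> measure lebesgue U" if "D' \<subseteq> \<D>" "finite D'" for D'
    using that D(2,4) lmD
    by (intro measure_mono_fmeasurable lmU fmeasurableD fmeasurable.finite_Union) auto
  obtain D' where D': "D' \<subseteq> \<D>" "finite D'" "t < measure lebesgue (\<Union>D')"
    using measure_countable_Union_approachable[of \<D> "measure lebesgue U - t" "measure lebesgue U"]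
      D(1,4) t lmD bnd by auto
  obtain p where p: "p division_of (\<Union>D')"
    using elementary_unions_intervals[OF D'(2)] D'(1) D(3) by blast
  define \<A> where "\<A> = interior ` p - {{}}"
  have sub: "\<Union>\<A> \<subseteq> \<Union>D'"
  proof
    fix x assume "x \<in> \<Union>\<A>"
    then obtain K where "K \<in> p" "x \<in> interior K" by (auto simp: \<A>_def)
    then show "x \<in> \<Union>D'" using interior_subset division_ofD(6)[OF p] by blast
  qed
  have "negligible (\<Union>K\<in>p. frontier K)"
  proof (intro negligible_Union ballI)
    show "finite (frontier ` p)" using division_ofD(1)[OF p] by simp
    fix F assume "F \<in> frontier ` p"
    then obtain K where "K \<in> p" "F = frontier K" by blast
    moreover from \<open>K \<in> p\<close> obtain a b where "K = cbox a b" using division_ofD(4)[OF p] by blast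
    ultimately show "negligible F" by (simp add: negligible_convex_frontier)
  qed
  moreover have "\<Union>D' - \<Union>\<A> \<subseteq> (\<Union>K\<in>p. frontier K)"
  proof
    fix x assume x: "x \<in> \<Union>D' - \<Union>\<A>"
    then obtain K where "K \<in> p" "x \<in> K" using division_ofD(6)[OF p] by blast
    then show "x \<in> (\<Union>K\<in>p. frontier K)"
      using x closure_subset[of K] by (auto simp: \<A>_def frontier_def)
  qed
  ultimately have neg: "negligible (\<Union>D' - \<Union>\<A>)" by (rule negligible_subset)
  have "\<Union>D' \<in> lmeasurable" using D' lmD by (intro fmeasurable.finite_Union) auto
  then have m: "measure lebesgue (\<Union>\<A>) = measure lebesgue (\<Union>D')"
    using neg sub by (intro measure_negligible_symdiff) (auto simp: Diff_eq_empty_iff[THEN iffD2])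
  show ?thesis
  proof
    show "t < measure lebesgue (\<Union>\<A>)" using m D'(3) by simp
    then have "\<A> \<noteq> {}" using t(1) by auto
    moreover have "finite \<A>" using p by (auto simp: \<A>_def)
    moreover have "disjoint \<A>"
      unfolding disjoint_def \<A>_def using division_ofD(5)[OF p] by blast
    moreover have "\<exists>l u. a = box l u" if a: "a \<in> \<A>" for a
    proof -
      obtain K where "K \<in> p" "a = interior K" using a by (auto simp: \<A>_def)
      then show ?thesis using division_ofD(4)[OF p] interior_cbox by metis
    qed
    ultimately show "box_family \<A>" by (auto simp: box_family_def \<A>_def)
    show "\<Union>\<A> \<subseteq> U" using sub D' D(4) by auto
  qed
qed

text \<open>The Brunn--Minkowski inequality for open sets, obtained from families of boxes inside
  \<open>U\<close> and \<open>W\<close> whose measures come arbitrarily close to those of \<open>U\<close> and \<open>W\<close>.\<close>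

theorem brunn_minkowski_open:
  fixes U W :: "'a::euclidean_space set"
  assumes U: "open U" "bounded U" "U \<noteq> {}" and W: "open W" "bounded W" "W \<noteq> {}"
  shows "root DIM('a) (measure lebesgue U) + root DIM('a) (measure lebesgue W)
           \<le> root DIM('a) (measure lebesgue (U + W))"
proof -
  let ?n = "DIM('a)"
  have approx: "\<exists>\<A>. box_family \<A> \<and> \<Union>\<A> \<subseteq> X \<and> a \<le> root ?n (measure lebesgue (\<Union>\<A>))"
    if X: "open X" "bounded X" "X \<noteq> {}" and a: "a < root ?n (measure lebesgue X)" for X :: "'a set" and a
  proof -
    have pos: "0 < measure lebesgue X"
      using X by (rule measure_open_pos)
    \<comment> \<open>A negative \<open>a\<close> is raised to 0, since its power could exceed the measure of \<open>X\<close>.\<close>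
    then have "max a 0 < root ?n (measure lebesgue X)" using a by (simp add: real_root_gt_zero)
    then have "max a 0 ^ ?n < root ?n (measure lebesgue X) ^ ?n"
      by (intro power_strict_mono) auto
    also have "\<dots> = measure lebesgue X" by (simp add: real_root_pow_pos2)
    finally obtain \<A> where A: "box_family \<A>" "\<Union>\<A> \<subseteq> X" "max a 0 ^ ?n < measure lebesgue (\<Union>\<A>)"
      using box_family_approximates_open[OF X(1,2)] by (metis max.cobounded2 zero_le_power)
    have "a \<le> root ?n (max a 0 ^ ?n)" by (simp add: real_root_power_cancel)
    also have "\<dots> \<le> root ?n (measure lebesgue (\<Union>\<A>))" using A(3) by simp
    finally show ?thesis using A by blast
  qed
  have "a + b \<le> root ?n (measure lebesgue (U + W))"
    if ab: "a < root ?n (measure lebesgue U)" "b < root ?n (measure lebesgue W)" for a b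
  proof -
    obtain \<A> \<B> where A: "box_family \<A>" "\<Union>\<A> \<subseteq> U" "a \<le> root ?n (measure lebesgue (\<Union>\<A>))"
      and B: "box_family \<B>" "\<Union>\<B> \<subseteq> W" "b \<le> root ?n (measure lebesgue (\<Union>\<B>))"
      using approx[OF U ab(1)] approx[OF W ab(2)] by blast
    let ?s = "root ?n (measure lebesgue (\<Union>\<A>)) + root ?n (measure lebesgue (\<Union>\<B>))"
    have "a + b \<le> ?s" using A B by simp
    also have "?s = root ?n (?s ^ ?n)"
      by (intro real_root_power_cancel[symmetric]) (auto intro!: add_nonneg_nonneg real_root_ge_zero)
    also have "\<dots> \<le> root ?n (measure lebesgue (\<Union>\<A> + \<Union>\<B>))"
      using brunn_minkowski_box_family[OF A(1) B(1)] by (simp add: brunn_minkowski_def)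
    also have "\<dots> \<le> root ?n (measure lebesgue (U + W))"
      using set_plus_mono2[OF A(2) B(2)] U W box_family_Union[OF A(1)] box_family_Union[OF B(1)]
      by (simp del: measure_completion)
        (intro measure_mono_fmeasurable fmeasurableD lmeasurable_open_sum; assumption)
    finally show ?thesis .
  qed
  note sum_le = this
  let ?R = "root ?n (measure lebesgue (U + W))"
  have "a \<le> ?R - root ?n (measure lebesgue W)" if a: "a < root ?n (measure lebesgue U)" for a
  proof -
    have "root ?n (measure lebesgue W) \<le> ?R - a"
    proof (rule dense_le)
      fix b assume "b < root ?n (measure lebesgue W)"
      then show "b \<le> ?R - a" using sum_le[OF a, of b] by linarith
    qed
    then show ?thesis by simp
  qed
  then have "root ?n (measure lebesgue U) \<le> ?R - root ?n (measure lebesgue W)"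
    by (rule dense_le)
  then show ?thesis by simp
qed

section \<open>Neighbourhoods in the norm of a symmetric convex body\<close>

lemma image_ball_K: "ball_K K x r = (\<lambda>k. r *\<^sub>R k + x) ` K"
  by (auto simp: ball_K_def image_image add.commute)

lemma measure_ball_K: "measure lebesgue (ball_K K x r) = \<bar>r\<bar> ^ CARD('d) * measure lebesgue K"
  for K :: "(real ^ 'd) set"
  unfolding image_ball_K by (simp add: measure_lebesgue_affine del: measure_completion)

lemma open_ball_K: "open K \<Longrightarrow> r \<noteq> 0 \<Longrightarrow> open (ball_K K x r)"
  unfolding ball_K_def by (intro open_translation open_scaling)

lemma bounded_ball_K: "bounded K \<Longrightarrow> bounded (ball_K K x r)"
  unfolding ball_K_def by (intro bounded_translation bounded_scaling)

lemma open_nbhd_K: "open K \<Longrightarrow> r \<noteq> 0 \<Longrightarrow> open (nbhd_K K X r)"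
  unfolding nbhd_K_def by (intro open_UN ballI open_ball_K)

lemma bounded_nbhd_K: "bounded K \<Longrightarrow> finite X \<Longrightarrow> bounded (nbhd_K K X r)"
  unfolding nbhd_K_def by (intro bounded_UN ballI bounded_ball_K)

lemma nbhd_K_nonempty: "K \<noteq> {} \<Longrightarrow> X \<noteq> {} \<Longrightarrow> nbhd_K K X r \<noteq> {}"
  by (auto simp: nbhd_K_def ball_K_def)

lemma negligible_ball_K_frontier:
  assumes "convex K" "r \<noteq> 0"
  shows "negligible (ball_K K x r - ball_K (interior K) x r)"
proof -
  have "convex (ball_K K x r)"
    unfolding ball_K_def using assms by (intro convex_translation convex_scaling)
  then have "negligible (frontier (ball_K K x r))" by (rule negligible_convex_frontier)
  moreover have "interior (ball_K K x r) = ball_K (interior K) x r"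
    unfolding ball_K_def interior_translation using assms(2)
    by (subst interior_injective_linear_image) (auto simp: injective_scaleR linear_scaleR)
  ultimately show ?thesis
    using closure_subset by (auto simp: frontier_def elim!: negligible_subset)
qed

text \<open>A finite union of convex bodies has the same measure as the union of their interiors,
  because the boundary of a convex set is a null set. This allows open neighbourhoods to be
  used from here on, for which sums are open and hence measurable.\<close>

lemma measure_nbhd_K_interior:
  fixes K :: "(real ^ 'd) set"
  assumes "convex K" "bounded K" "finite X" "r \<noteq> 0"
  shows "measure lebesgue (nbhd_K K X r) = measure lebesgue (nbhd_K (interior K) X r)"
proof (rule measure_negligible_symdiff)
  show "nbhd_K (interior K) X r \<in> lmeasurable"
    using assms by (auto intro!: lmeasurable_open open_nbhd_K bounded_nbhd_K bounded_interior)
  have "negligible (\<Union>x\<in>X. ball_K K x r - ball_K (interior K) x r)"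
    using assms by (intro negligible_Union) (auto intro: negligible_ball_K_frontier)
  moreover have "ball_K (interior K) x r \<subseteq> ball_K K x r" for x
    using interior_subset by (auto simp: ball_K_def)
  ultimately show "negligible (nbhd_K (interior K) X r - nbhd_K K X r \<union> (nbhd_K K X r - nbhd_K (interior K) X r))"
    by (elim negligible_subset) (auto simp: nbhd_K_def)
qed

lemma nbhd_K_plus_ball_K_subset:
  assumes "convex K" "0 < s" "0 < t"
  shows "nbhd_K K X s + ball_K K 0 t \<subseteq> nbhd_K K X (s + t)"
proof
  fix z assume "z \<in> nbhd_K K X s + ball_K K 0 t"
  then obtain x a b where x: "x \<in> X" and ab: "a \<in> K" "b \<in> K" and z: "z = x + s *\<^sub>R a + t *\<^sub>R b"
    by (auto simp: nbhd_K_def ball_K_def elim!: set_plus_elim)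
  define c where "c = (s / (s + t)) *\<^sub>R a + (t / (s + t)) *\<^sub>R b"
  have "c \<in> K"
    unfolding c_def using assms ab
    by (intro convexD[OF assms(1)]) (auto simp: add_divide_distrib[symmetric])
  moreover have "z = x + (s + t) *\<^sub>R c"
    using assms by (simp add: z c_def scaleR_right_distrib add.assoc)
  ultimately show "z \<in> nbhd_K K X (s + t)"
    using x by (auto simp: nbhd_K_def ball_K_def)
qed

lemma norm_K_le_imp_mem:
  assumes K: "o_symmetric_convex_body K" and "norm_K K x \<le> t"
  shows "x \<in> (*\<^sub>R) t ` K"
proof -
  define s where "s = norm_K K x"
  have s: "0 \<le> s" "s \<le> t" "x \<in> (*\<^sub>R) s ` K"
    using norm_K_attained(1)[OF K, of x] assms(2) by (auto simp: s_def)
  have cvx: "convex K" and zero: "0 \<in> K"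
    using K zero_in_interior_o_symmetric[OF K] interior_subset by (auto simp: o_symmetric_convex_body_def)
  obtain k where k: "k \<in> K" "x = s *\<^sub>R k" using s(3) by auto
  show ?thesis
  proof (cases "t = 0")
    case True
    then show ?thesis using s k zero by (auto intro!: image_eqI[of _ _ 0])
  next
    case False
    then have "(s / t) *\<^sub>R k + (1 - s / t) *\<^sub>R 0 \<in> K"
      using s k zero by (intro convexD[OF cvx]) (auto simp: divide_simps)
    then show ?thesis using False k by (intro image_eqI[of _ _ "(s / t) *\<^sub>R k"]) auto
  qed
qed

text \<open>The strict bound is due to the room around an interior point: a slightly longer multiple
  of \<open>x\<close> is still in \<open>K\<close>.\<close>

lemma norm_K_less:
  assumes K: "o_symmetric_convex_body K" and t: "0 < t" and x: "x \<in> interior K"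
  shows "norm_K K (t *\<^sub>R x) < t"
proof -
  obtain e where e: "0 < e" "ball x e \<subseteq> K" using x mem_interior by blast
  define d where "d = e / (2 * (norm x + 1))"
  have d: "0 < d" using e by (auto simp: d_def intro!: divide_pos_pos add_nonneg_pos)
  have "dist x ((1 + d) *\<^sub>R x) = d * norm x"
    using d by (simp add: dist_norm scaleR_left_distrib)
  also have "\<dots> < e"
  proof -
    have "d * norm x \<le> d * (norm x + 1)" using d by simp
    also have "\<dots> = e / 2"
    proof -
      have "norm x + 1 \<noteq> 0" using norm_ge_zero[of x] by linarith
      then show ?thesis unfolding d_def by (simp add: field_simps)
    qed
    finally show ?thesis using e by simp
  qed
  finally have "(1 + d) *\<^sub>R x \<in> K" using e by auto
  moreover have "t *\<^sub>R x = (t / (1 + d)) *\<^sub>R ((1 + d) *\<^sub>R x)" using d by simp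
  ultimately have "norm_K K (t *\<^sub>R x) \<le> t / (1 + d)"
    using t d by (intro norm_K_attained(2)[OF K] image_eqI[of _ _ "(1 + d) *\<^sub>R x"]) simp_all
  also have "\<dots> < t" using t d by (simp add: divide_less_eq)
  finally show ?thesis .
qed

lemma uminus_interior_o_symmetric:
  assumes "o_symmetric_convex_body K"
  shows "uminus ` interior K = interior K"
  using assms interior_negations[of K] by (simp add: o_symmetric_convex_body_def)

lemma norm_K_minus:
  assumes "o_symmetric_convex_body K"
  shows "norm_K K (- x) = norm_K K x"
proof -
  have "- x \<in> (*\<^sub>R) t ` K \<longleftrightarrow> x \<in> (*\<^sub>R) t ` K" for t
  proof -
    have "(*\<^sub>R) t ` uminus ` K = uminus ` (*\<^sub>R) t ` K" by (simp add: image_image)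
    then have "(*\<^sub>R) t ` K = uminus ` (*\<^sub>R) t ` K" using assms by (simp add: o_symmetric_convex_body_def)
    then show ?thesis by (metis imageI minus_minus)
  qed
  then show ?thesis by (simp add: norm_K_def)
qed

text \<open>A common point \<open>x + r a = y + r b\<close> would give \<open>x - y = 2 r ((b - a) / 2)\<close>, and the
  midpoint \<open>(b - a) / 2\<close> is interior to \<open>K\<close> by convexity and symmetry.\<close>

lemma disjoint_open_balls_K:
  assumes K: "o_symmetric_convex_body K" and r: "0 < r" "2 * r \<le> norm_K K (x - y)"
  shows "ball_K (interior K) x r \<inter> ball_K (interior K) y r = {}"
proof (rule ccontr)
  assume "ball_K (interior K) x r \<inter> ball_K (interior K) y r \<noteq> {}"
  then obtain a b where ab: "a \<in> interior K" "b \<in> interior K" "x + r *\<^sub>R a = y + r *\<^sub>R b"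
    by (auto simp: ball_K_def)
  have "- a \<in> interior K" using ab uminus_interior_o_symmetric[OF K] by blast
  then have "(1/2) *\<^sub>R b + (1/2) *\<^sub>R (- a) \<in> interior K"
    using ab K by (intro convexD convex_interior) (auto simp: o_symmetric_convex_body_def)
  then have "norm_K K ((2 * r) *\<^sub>R ((1/2) *\<^sub>R b + (1/2) *\<^sub>R (- a))) < 2 * r"
    using r by (intro norm_K_less[OF K]) auto
  moreover have "(2 * r) *\<^sub>R ((1/2) *\<^sub>R b + (1/2) *\<^sub>R (- a)) = x - y"
    using ab(3) by (simp add: scaleR_right_distrib algebra_simps)
  ultimately show False using r by simp
qed

lemma measure_packing_K:
  fixes K :: "(real ^ 'd) set"
  assumes K: "o_symmetric_convex_body K" and "finite I" and r: "0 < r"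
    and sep: "\<And>i j. i \<in> I \<Longrightarrow> j \<in> I \<Longrightarrow> i \<noteq> j \<Longrightarrow> 2 * r \<le> norm_K K (p i - p j)"
  shows "measure lebesgue (nbhd_K (interior K) (p ` I) r) = card I * (r ^ CARD('d) * measure lebesgue (interior K))"
proof -
  have bdd: "bounded K" using K by (simp add: o_symmetric_convex_body_def compact_imp_bounded)
  have "measure lebesgue (\<Union>i\<in>I. ball_K (interior K) (p i) r)
        = (\<Sum>i\<in>I. measure lebesgue (ball_K (interior K) (p i) r))"
  proof (rule measure_negligible_finite_Union_image[OF assms(2)])
    show "ball_K (interior K) (p i) r \<in> lmeasurable" for i
      using r bdd by (intro lmeasurable_open bounded_ball_K open_ball_K bounded_interior) auto
    show "pairwise (\<lambda>i j. negligible (ball_K (interior K) (p i) r \<inter> ball_K (interior K) (p j) r)) I"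
      using disjoint_open_balls_K[OF K r sep] by (simp add: pairwise_def)
  qed
  then show ?thesis
    using r by (simp add: nbhd_K_def measure_ball_K del: measure_completion)
qed

lemma measure_nbhd_K_le_card:
  fixes K :: "(real ^ 'd) set"
  assumes "bounded K" "finite I" "0 < r"
  shows "measure lebesgue (nbhd_K (interior K) (q ` I) r) \<le> card I * (r ^ CARD('d) * measure lebesgue (interior K))"
proof -
  have "measure lebesgue (\<Union>i\<in>I. ball_K (interior K) (q i) r)
        \<le> (\<Sum>i\<in>I. measure lebesgue (ball_K (interior K) (q i) r))"
    using assms
    by (intro measure_UNION_le fmeasurableD lmeasurable_open bounded_ball_K open_ball_K bounded_interior) auto
  then show ?thesis
    using assms by (simp add: nbhd_K_def measure_ball_K del: measure_completion)
qed

section \<open>Volume bounds for sets of bounded diameter and for separated sets\<close>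

lemma measure_uminus_image: "measure lebesgue (uminus ` S) = measure lebesgue S"
  for S :: "'a::euclidean_space set"
  using measure_lebesgue_affine[of "-1" 0 S] by (simp del: measure_completion)

text \<open>The isodiametric inequality for the norm of \<open>K\<close>, following Bieberbach. The neighbourhood
  \<open>U\<close> has diameter at most \<open>l + 2 r\<close>, so \<open>U + (- U)\<close> lies in the ball of that radius, while
  the Brunn--Minkowski inequality bounds its measure below by that of \<open>2 U\<close>.\<close>

lemma isodiametric_nbhd_K:
  fixes K :: "(real ^ 'd) set"
  assumes K: "o_symmetric_convex_body K" and X: "finite X" "X \<noteq> {}" and r: "0 < r" and l: "0 < l"
    and diam: "\<And>x y. x \<in> X \<Longrightarrow> y \<in> X \<Longrightarrow> norm_K K (x - y) \<le> l"
  shows "root CARD('d) (measure lebesgue (nbhd_K (interior K) X r))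
           \<le> (l / 2 + r) * root CARD('d) (measure lebesgue (interior K))"
proof -
  let ?d = "CARD('d)" and ?U = "nbhd_K (interior K) X r"
  have cvx: "convex K" and bdd: "bounded K" and ne: "interior K \<noteq> {}"
    using K by (auto simp: o_symmetric_convex_body_def compact_imp_bounded)
  have U: "open ?U" "bounded ?U" "?U \<noteq> {}"
    using r X bdd ne by (simp_all add: open_nbhd_K bounded_nbhd_K bounded_interior nbhd_K_nonempty)
  have sub: "?U + uminus ` ?U \<subseteq> ball_K (interior K) 0 (l + 2 * r)"
  proof
    fix z assume "z \<in> ?U + uminus ` ?U"
    then obtain x y a b where xy: "x \<in> X" "y \<in> X" and ab: "a \<in> interior K" "b \<in> interior K"
      and z: "z = x + r *\<^sub>R a + - (y + r *\<^sub>R b)"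
      by (auto simp: nbhd_K_def ball_K_def elim!: set_plus_elim)
    obtain k where k: "k \<in> K" "x - y = l *\<^sub>R k"
      using norm_K_le_imp_mem[OF K diam[OF xy]] by auto
    have "- b \<in> interior K" using ab uminus_interior_o_symmetric[OF K] by blast
    then have m: "(1/2) *\<^sub>R a + (1/2) *\<^sub>R (- b) \<in> interior K"
      using ab cvx by (intro convexD convex_interior) auto
    define c where "c = (1/2) *\<^sub>R a + (1/2) *\<^sub>R (- b)"
    \<comment> \<open>The vector \<open>z = l k + 2 r c\<close> divided by \<open>l + 2 r\<close> is a convex combination of \<open>k\<close> in
      \<open>K\<close> and \<open>c\<close> in its interior with the positive weight \<open>e\<close> on \<open>c\<close>.\<close>
    define e where "e = 2 * r / (l + 2 * r)"
    have e: "0 < e" "e \<le> 1" using r l by (auto simp: e_def divide_simps)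
    have "k - e *\<^sub>R (k - c) \<in> interior K"
      using m k e by (intro mem_interior_convex_shrink cvx) (auto simp: c_def)
    moreover have "z = (l + 2 * r) *\<^sub>R (k - e *\<^sub>R (k - c))"
    proof -
      have "(l + 2 * r) * e = 2 * r" using r l by (simp add: e_def)
      then have "(l + 2 * r) *\<^sub>R (k - e *\<^sub>R (k - c)) = (l + 2 * r) *\<^sub>R k - (2 * r) *\<^sub>R (k - c)"
        by (simp add: scaleR_right_diff_distrib)
      also have "\<dots> = l *\<^sub>R k + (2 * r) *\<^sub>R c" by (simp add: algebra_simps)
      also have "\<dots> = z" unfolding k(2)[symmetric] z c_def by (simp add: algebra_simps)
      finally show ?thesis by simp
    qed
    ultimately show "z \<in> ball_K (interior K) 0 (l + 2 * r)" by (auto simp: ball_K_def)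
  qed
  have nU: "open (uminus ` ?U)" "bounded (uminus ` ?U)" "uminus ` ?U \<noteq> {}"
    using U by (auto simp: open_negations)
  have "2 * root ?d (measure lebesgue ?U) = root ?d (measure lebesgue ?U) + root ?d (measure lebesgue (uminus ` ?U))"
    by (simp add: measure_uminus_image del: measure_completion)
  also have "\<dots> \<le> root ?d (measure lebesgue (?U + uminus ` ?U))"
    using brunn_minkowski_open[OF U nU] by simp
  also have "\<dots> \<le> root ?d (measure lebesgue (ball_K (interior K) 0 (l + 2 * r)))"
    using sub U nU r l bdd
    by (intro real_root_le_mono measure_mono_fmeasurable fmeasurableD lmeasurable_open_sum
        lmeasurable_open open_ball_K bounded_ball_K bounded_interior) auto
  also have "\<dots> = (l + 2 * r) * root ?d (measure lebesgue (interior K))"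
    using r l by (simp add: measure_ball_K real_root_mult real_root_power_cancel del: measure_completion)
  finally show ?thesis by (simp add: algebra_simps)
qed

text \<open>The balls of radius \<open>s\<close> around the points are disjoint, so that together they measure
  at least as much as a single ball of radius \<open>2 s\<close>; this is what the number of points is
  needed for. Enlarging them by \<open>r - s\<close> gives, by the Brunn--Minkowski inequality, at least
  the measure of a ball of radius \<open>2 s + (r - s) = s + r\<close>.\<close>

lemma nbhd_K_packing_lower_bound:
  fixes K :: "(real ^ 'd) set"
  assumes K: "o_symmetric_convex_body K" and I: "finite I" "2 ^ CARD('d) \<le> card I"
    and r: "0 < s" "s < r"
    and sep: "\<And>i j. i \<in> I \<Longrightarrow> j \<in> I \<Longrightarrow> i \<noteq> j \<Longrightarrow> 2 * s \<le> norm_K K (p i - p j)"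
  shows "(s + r) * root CARD('d) (measure lebesgue (interior K))
           \<le> root CARD('d) (measure lebesgue (nbhd_K (interior K) (p ` I) r))"
proof -
  let ?d = "CARD('d)" and ?U = "nbhd_K (interior K) (p ` I) s" and ?B = "ball_K (interior K) 0 (r - s)"
    and ?W = "nbhd_K (interior K) (p ` I) r"
  define C where "C = root ?d (measure lebesgue (interior K))"
  have C: "0 \<le> C" by (simp add: C_def real_root_ge_zero)
  have cvx: "convex K" and bdd: "bounded K" and ne: "interior K \<noteq> {}"
    using K by (auto simp: o_symmetric_convex_body_def compact_imp_bounded)
  have "I \<noteq> {}" using I(2) by auto
  then have U: "open ?U" "bounded ?U" "?U \<noteq> {}"
    using r I bdd ne by (simp_all add: open_nbhd_K bounded_nbhd_K bounded_interior nbhd_K_nonempty)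
  have W: "?W \<in> lmeasurable"
    using r I bdd by (auto intro!: lmeasurable_open open_nbhd_K bounded_nbhd_K bounded_interior)
  have B: "open ?B" "bounded ?B"
    using r bdd by (simp_all add: open_ball_K bounded_ball_K bounded_interior)
  have B_ne: "?B \<noteq> {}" using ne by (simp add: ball_K_def)
  have "2 = root ?d (2 ^ ?d)" by (simp add: real_root_power_cancel)
  also have "\<dots> \<le> root ?d (real (card I))"
    using I(2) by (intro real_root_le_mono) (auto simp: numeral_power_le_of_nat_cancel_iff)
  finally have two: "2 \<le> root ?d (real (card I))" .
  have "root ?d (measure lebesgue ?U) = root ?d (real (card I)) * (s * C)"
    using measure_packing_K[OF K I(1) r(1) sep] r
    by (simp add: real_root_mult real_root_power_cancel C_def del: measure_completion)
  also have "2 * (s * C) \<le> \<dots>" using two r C by (intro mult_right_mono) auto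
  finally have "2 * (s * C) \<le> root ?d (measure lebesgue ?U)" .
  moreover have "root ?d (measure lebesgue ?B) = (r - s) * C"
    using r by (simp add: measure_ball_K real_root_mult real_root_power_cancel C_def del: measure_completion)
  ultimately have "(s + r) * C \<le> root ?d (measure lebesgue ?U) + root ?d (measure lebesgue ?B)"
    by (simp add: algebra_simps)
  also have "\<dots> \<le> root ?d (measure lebesgue (?U + ?B))"
    using brunn_minkowski_open[OF U B B_ne] by simp
  also have "\<dots> \<le> root ?d (measure lebesgue ?W)"
    using nbhd_K_plus_ball_K_subset[OF convex_interior[OF cvx] r(1), of "r - s" "p ` I"] r U B W
    by (intro real_root_le_mono measure_mono_fmeasurable fmeasurableD lmeasurable_open_sum) auto
  finally show ?thesis by (simp add: C_def)
qed

section \<open>Uniform contractions\<close>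

theorem theorem2:
  fixes K :: "(real ^ 'd) set" and p q :: "nat \<Rightarrow> real ^ 'd"
    and r l :: real and N :: nat
  assumes "CARD('d) > 1"
    and "o_symmetric_convex_body K"
    and "r > 0"
    and "l > 0"
    and "N \<ge> 2 ^ CARD('d)"
    and "uniform_contraction K N l q p"
  shows "measure lebesgue (nbhd_K K (q ` {1..N}) r) \<le> measure lebesgue (nbhd_K K (p ` {1..N}) r)"
proof -
  note K = assms(2)
  have cvx: "convex K" and bdd: "bounded K"
    using K by (auto simp: o_symmetric_convex_body_def compact_imp_bounded)
  have pair: "norm_K K (q i - q j) \<le> l \<and> l \<le> norm_K K (p i - p j)"
    if "i \<in> {1..N}" "j \<in> {1..N}" "i \<noteq> j" for i j
  proof -
    have lt: "norm_K K (q a - q b) \<le> l \<and> l \<le> norm_K K (p a - p b)"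
      if "a \<in> {1..N}" "b \<in> {1..N}" "a < b" for a b
      using assms(6) that by (auto simp: uniform_contraction_def)
    show ?thesis
      using lt[of i j] lt[of j i] that norm_K_minus[OF K, of "q i - q j"] norm_K_minus[OF K, of "p i - p j"]
      by (cases "i < j") auto
  qed
  let ?VQ = "measure lebesgue (nbhd_K (interior K) (q ` {1..N}) r)"
  let ?VP = "measure lebesgue (nbhd_K (interior K) (p ` {1..N}) r)"
  have "?VQ \<le> ?VP"
  proof (cases "2 * r \<le> l")
    case True
    have "2 * r \<le> norm_K K (p i - p j)" if "i \<in> {1..N}" "j \<in> {1..N}" "i \<noteq> j" for i j
      using pair[OF that] True by linarith
    then show ?thesis
      using measure_nbhd_K_le_card[OF bdd _ \<open>r > 0\<close>, of "{1..N}" q] measure_packing_K[OF K _ \<open>r > 0\<close>, of "{1..N}" p]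
      by simp
  next
    case False
    have N: "{1..N} \<noteq> {}" using \<open>N \<ge> 2 ^ CARD('d)\<close> by (cases N) auto
    have diam: "norm_K K (x - y) \<le> l" if xy: "x \<in> q ` {1..N}" "y \<in> q ` {1..N}" for x y
    proof -
      obtain i j where ij: "i \<in> {1..N}" "j \<in> {1..N}" "x = q i" "y = q j"
        using xy by blast
      have "norm_K K 0 \<le> 0"
        using zero_in_interior_o_symmetric[OF K] interior_subset
        by (intro norm_K_attained(2)[OF K]) auto
      then show ?thesis using ij pair[of i j] \<open>l > 0\<close> by (cases "i = j") auto
    qed
    have sep: "2 * (l / 2) \<le> norm_K K (p i - p j)" if "i \<in> {1..N}" "j \<in> {1..N}" "i \<noteq> j" for i j
      using pair[OF that] by simp
    have "root CARD('d) ?VQ \<le> (l / 2 + r) * root CARD('d) (measure lebesgue (interior K))"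
      using N diam by (intro isodiametric_nbhd_K[OF K _ _ \<open>r > 0\<close> \<open>l > 0\<close>]) auto
    also have "\<dots> \<le> root CARD('d) ?VP"
      using False \<open>l > 0\<close> \<open>N \<ge> 2 ^ CARD('d)\<close> sep
      by (intro nbhd_K_packing_lower_bound[OF K]) auto
    finally show ?thesis by simp
  qed
  then show ?thesis
    using measure_nbhd_K_interior[OF cvx bdd, of "q ` {1..N}" r]
      measure_nbhd_K_interior[OF cvx bdd, of "p ` {1..N}" r] \<open>r > 0\<close> by simp
qed

end
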